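(* Let $\vec n\in\mathbb N_0^p$, $\vec m\in\mathbb N_0^q$ with $|\vec m|=|\vec n|-1$. Up to a nonzero constant, the type-I mixed Piñeiro form $A_{\vec n,\vec m}$ has, for $0<x<1$, the contour representation $$A_{\vec n,\vec m}(x)=\int_\Sigma\frac{x^t\prod_{j=1}^q(t+\beta_j+1)_{m_j}}{\prod_{i=1}^p(\alpha_i-t)_{n_i}}\,\frac{\mathrm dt}{2\pi\mathrm i},$$ where $\Sigma\subset\mathbb C$ is a clockwise contour enclosing once every point $\alpha_i,\alpha_i+1,\ldots,\alpha_i+n_i-1$, $1\le i\le p$, and no other pole of the integrand, and $x^t=\exp(t\log x)$ with the real logarithm.
   Context: $p,q\ge1$; real parameters satisfy $\alpha_i>-1$, $\beta_j>-1$, $\alpha_i+\beta_j>-1$ for all $1\le i\le p$, $1\le j\le q$; $\alpha_i-\alpha_h\notin\mathbb Z$ for $i\ne h$ and $\beta_j-\beta_s\notin\mathbb Z$ for $j\neq s$. $(z)_0=1$, $(z)_n=\prod_{r=0}^{n-1}(z+r)$; $|\cdot|$ is the sum of components of a multi-index. For $|\vec n|=|\vec m|+1$, a type-I mixed Piñeiro form is a nonzero function $A_{\vec n,\vec m}(x)=\sum_{i=1}^pA^{(i)}_{\vec n,\vec m}(x)x^{\alpha_i}$ with polynomials $\deg A^{(i)}_{\vec n,\vec m}\le n_i-1$ ($A^{(i)}\equiv0$ if $n_i=0$) such that $\int_0^1A_{\vec n,\vec m}(x)x^{k+\beta_j}\,\mathrm dx=0$ for $0\le k\le m_j-1$, $1\le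 j\le q$. Under the parameter assumptions the system is perfect (known fact): such a form is unique up to a nonzero constant factor. *)

theory Defs
  imports "HOL-Complex_Analysis.Complex_Analysis"
begin

text \<open>
  Multi-indices \<open>n\<close>, \<open>m\<close> and parameters \<open>\<alpha>\<close>, \<open>\<beta>\<close> are functions on \<open>nat\<close>, of which only the
  values on \<open>{1..p}\<close> resp. \<open>{1..q}\<close> are used.
\<close>

definition pineiro_parameters ::
  "nat \<Rightarrow> nat \<Rightarrow> (nat \<Rightarrow> real) \<Rightarrow> (nat \<Rightarrow> real) \<Rightarrow> bool" where
  "pineiro_parameters p q \<alpha> \<beta> \<longleftrightarrow>
     (\<forall>i\<in>{1..p}. \<alpha> i > -1) \<and>
     (\<forall>j\<in>{1..q}. \<beta> j > -1) \<and>
     (\<forall>i\<in>{1..p}. \<forall>j\<in>{1..q}. \<alpha> i + \<beta> j > -1) \<and>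
     (\<forall>i\<in>{1..p}. \<forall>h\<in>{1..p}. i \<noteq> h \<longrightarrow> \<alpha> i - \<alpha> h \<notin> \<int>) \<and>
     (\<forall>j\<in>{1..q}. \<forall>s\<in>{1..q}. j \<noteq> s \<longrightarrow> \<beta> j - \<beta> s \<notin> \<int>)"

text \<open>
  A form is regarded as a function on the open interval \<open>(0,1)\<close>; the values of \<open>A\<close> elsewhere are
  irrelevant, and ``nonzero'' means not identically zero on \<open>(0,1)\<close>.
\<close>

definition type_I_mixed_pineiro_form ::
  "nat \<Rightarrow> nat \<Rightarrow> (nat \<Rightarrow> real) \<Rightarrow> (nat \<Rightarrow> real) \<Rightarrow> (nat \<Rightarrow> nat) \<Rightarrow> (nat \<Rightarrow> nat) \<Rightarrow>
     (real \<Rightarrow> real) \<Rightarrow> bool" where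
  "type_I_mixed_pineiro_form p q \<alpha> \<beta> n m A \<longleftrightarrow>
     (\<exists>P :: nat \<Rightarrow> real poly.
        (\<forall>i\<in>{1..p}. degree (P i) \<le> n i - 1 \<and> (n i = 0 \<longrightarrow> P i = 0)) \<and>
        (\<forall>x\<in>{0<..<1}. A x = (\<Sum>i=1..p. poly (P i) x * x powr \<alpha> i))) \<and>
     (\<exists>x\<in>{0<..<1}. A x \<noteq> 0) \<and>
     (\<forall>j\<in>{1..q}. \<forall>k<m j.
        ((\<lambda>x. A x * x powr (real k + \<beta> j)) has_integral 0) {0<..<1})"

definition pineiro_integrand ::
  "nat \<Rightarrow> nat \<Rightarrow> (nat \<Rightarrow> real) \<Rightarrow> (nat \<Rightarrow> real) \<Rightarrow> (nat \<Rightarrow> nat) \<Rightarrow> (nat \<Rightarrow> nat) \<Rightarrow>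
     real \<Rightarrow> complex \<Rightarrow> complex" where
  "pineiro_integrand p q \<alpha> \<beta> n m x t =
     exp (t * complex_of_real (ln x)) *
     (\<Prod>j=1..q. pochhammer (t + complex_of_real (\<beta> j) + 1) (m j)) /
     (\<Prod>i=1..p. pochhammer (complex_of_real (\<alpha> i) - t) (n i))"

definition pineiro_nodes :: "nat \<Rightarrow> (nat \<Rightarrow> real) \<Rightarrow> (nat \<Rightarrow> nat) \<Rightarrow> complex set" where
  "pineiro_nodes p \<alpha> n = {complex_of_real (\<alpha> i + real r) | i r. i \<in> {1..p} \<and> r < n i}"

text \<open>
  Simplicity of the curve is not required: ``clockwise'' and ``enclosing once'' are both expressed
  by the winding number \<open>-1\<close>.
\<close>

definition clockwise_contour_around :: "complex set \<Rightarrow> (real \<Rightarrow> complex) \<Rightarrow> bool" where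
  "clockwise_contour_around S \<gamma> \<longleftrightarrow>
     valid_path \<gamma> \<and> pathfinish \<gamma> = pathstart \<gamma> \<and>
     (\<forall>z\<in>S. z \<notin> path_image \<gamma> \<and> winding_number \<gamma> z = -1)"

definition encloses_no_other_pole ::
  "complex set \<Rightarrow> (complex \<Rightarrow> complex) \<Rightarrow> (real \<Rightarrow> complex) \<Rightarrow> bool" where
  "encloses_no_other_pole S f \<gamma> \<longleftrightarrow>
     (\<forall>z. is_pole f z \<and> z \<notin> S \<longrightarrow> z \<notin> path_image \<gamma> \<and> winding_number \<gamma> z = 0)"

end

theory Submission
  imports Defs
begin

text \<open>
  Let \<open>V\<close> be the set of the exponents \<open>\<alpha>\<^sub>i + r\<close> and \<open>W\<close> the set of the numbers \<open>\<beta>\<^sub>j + 1 + k\<close>, so that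
  \<open>card V = card W + 1\<close>. A function \<open>\<Sum>v\<in>V. c\<^sub>v x\<^sup>v\<close> satisfies the orthogonality conditions iff the
  rational function \<open>\<Sum>v\<in>V. c\<^sub>v / (v - t)\<close> vanishes at \<open>t = -w\<close> for all \<open>w \<in> W\<close>. Its numerator over
  the common denominator has degree at most \<open>card W\<close>, so it is a multiple of \<open>\<Prod>w\<in>W. (t + w)\<close>;
  this determines \<open>c\<close> up to a constant. The contour integral is evaluated by
  decomposing the integrand into the same partial fractions.
\<close>

section \<open>Partial fractions with simple poles over a field\<close>

text \<open>The sum of the fractions \<open>c v / (v - t)\<close>, multiplied by all
  \<open>v - t\<close> and read as a polynomial in \<open>t\<close>. Being free of division, it can
  also be evaluated at the nodes. The sign \<open>u - t\<close> matches the factors of the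
  Pochhammer symbols in \<open>\<alpha> i - t\<close>.\<close>

definition partial_fraction_numerator :: "'a::field set \<Rightarrow> ('a \<Rightarrow> 'a) \<Rightarrow> 'a poly" where
  "partial_fraction_numerator V c = (\<Sum>v\<in>V. smult (c v) (\<Prod>u\<in>V - {v}. [:u, -1:]))"

lemma degree_partial_fraction_numerator:
  assumes "finite V" "V \<noteq> {}"
  shows "degree (partial_fraction_numerator V c) < card V"
proof -
  have "degree (smult (c v) (\<Prod>u\<in>V - {v}. [:u, -1:])) \<le> card V - 1" if "v \<in> V" for v
  proof -
    have "degree (\<Prod>u\<in>V - {v}. [:u, -1:]) \<le> (\<Sum>u\<in>V - {v}. degree [:u, -1:])"
      using degree_prod_sum_le[of "V - {v}" "\<lambda>u. [:u, -1:]"] assms by (simp add: o_def)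
    then show ?thesis
      using that assms degree_smult_le[of "c v" "\<Prod>u\<in>V - {v}. [:u, -1:]"]
      by (auto simp: card_Diff_singleton)
  qed
  then have "degree (partial_fraction_numerator V c) \<le> card V - 1"
    unfolding partial_fraction_numerator_def using assms by (intro degree_sum_le) auto
  moreover have "card V > 0"
    using assms by (simp add: card_gt_0_iff)
  ultimately show ?thesis by linarith
qed

text \<open>Every summand except the one for \<open>v\<close> contains the factor
  \<open>v - v\<close>. The numerator thus determines the coefficients.\<close>

lemma poly_partial_fraction_numerator_node:
  assumes "finite V" "v \<in> V"
  shows "poly (partial_fraction_numerator V c) v = c v * (\<Prod>u\<in>V - {v}. u - v)"
proof -
  have "(\<Prod>u\<in>V - {w}. u - v) = 0" if "w \<in> V - {v}" for w
    using assms that by (intro prod_zero) auto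
  then have "(\<Sum>w\<in>V - {v}. c w * (\<Prod>u\<in>V - {w}. u - v)) = 0"
    by (intro sum.neutral ballI) (simp only: mult_zero_right)
  then show ?thesis
    using assms
    by (simp add: partial_fraction_numerator_def poly_sum poly_prod sum.remove[of V v])
qed

lemma poly_partial_fraction_numerator:
  assumes "finite V" "t \<notin> V"
  shows "poly (partial_fraction_numerator V c) t = (\<Sum>v\<in>V. c v / (v - t)) * (\<Prod>v\<in>V. v - t)"
proof -
  have "(\<Prod>u\<in>V - {v}. u - t) = (\<Prod>u\<in>V. u - t) / (v - t)" if "v \<in> V" for v
    using assms that by (auto simp: prod.remove[of V v])
  then show ?thesis
    by (simp add: partial_fraction_numerator_def poly_sum poly_prod sum_distrib_right)
qed

text \<open>Lagrange interpolation: both polynomials have degree below \<open>card V\<close> and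
  agree on \<open>V\<close>.\<close>

lemma partial_fraction_numerator_interpolates:
  assumes "finite V" "degree P < card V"
  shows "partial_fraction_numerator V (\<lambda>v. poly P v / (\<Prod>u\<in>V - {v}. u - v)) = P"
proof (rule poly_eqI_degree[of V])
  fix v assume "v \<in> V"
  moreover have "(\<Prod>u\<in>V - {v}. u - v) \<noteq> 0"
    using assms by auto
  ultimately show
    "poly (partial_fraction_numerator V (\<lambda>v. poly P v / (\<Prod>u\<in>V - {v}. u - v))) v = poly P v"
    using assms by (simp add: poly_partial_fraction_numerator_node)
qed (use assms in \<open>auto intro!: degree_partial_fraction_numerator\<close>)

lemma partial_fraction_decomposition:
  fixes V :: "'a::field set"
  assumes "finite V" "degree P < card V" "t \<notin> V"
  shows "poly P t / (\<Prod>v\<in>V. v - t) = (\<Sum>v\<in>V. poly P v / (\<Prod>u\<in>V - {v}. u - v) / (v - t))"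
proof -
  have "(\<Prod>v\<in>V. v - t) \<noteq> 0"
    using assms by auto
  then show ?thesis
    using poly_partial_fraction_numerator[OF assms(1,3),
        of "\<lambda>v. poly P v / (\<Prod>u\<in>V - {v}. u - v)"]
    unfolding partial_fraction_numerator_interpolates[OF assms(1,2)]
    by (subst nonzero_divide_eq_eq)
qed

text \<open>Both directions amount to \<open>N = smult C Q\<close>, with \<open>N\<close> the
  numerator of the fractions and \<open>Q\<close> the product of the \<open>t + w\<close>. Since no
  \<open>- w\<close> is a node, denominators can be cleared there, and vanishing of the sum means
  that \<open>- w\<close> is a root of \<open>N\<close>.\<close>

lemma partial_fractions_vanish_iff:
  fixes V W :: "'a::field set"
  assumes fin: "finite V" "finite W" and card: "card V = card W + 1"
    and ne: "\<And>v w. v \<in> V \<Longrightarrow> w \<in> W \<Longrightarrow> v + w \<noteq> 0"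
  shows "(\<forall>w\<in>W. (\<Sum>v\<in>V. c v / (v + w)) = 0) \<longleftrightarrow>
    (\<exists>C. \<forall>v\<in>V. c v = C * ((\<Prod>w\<in>W. v + w) / (\<Prod>u\<in>V - {v}. u - v)))"
    (is "?L \<longleftrightarrow> ?R")
proof -
  define Q where "Q = (\<Prod>w\<in>W. [:w, 1:])"
  define N where "N = partial_fraction_numerator V c"
  have poly_Q: "poly Q t = (\<Prod>w\<in>W. t + w)" for t
    by (simp add: Q_def poly_prod add.commute)
  have deg_Q: "degree Q < card V"
    using degree_prod_sum_le[of W "\<lambda>w. [:w, 1:]"] fin card by (simp add: Q_def o_def)
  have V_ne: "V \<noteq> {}"
    using card by auto
  have deg_N: "degree N < card V"
    unfolding N_def by (rule degree_partial_fraction_numerator[OF fin(1) V_ne])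
  have den_ne: "(\<Prod>u\<in>V - {v}. u - v) \<noteq> 0" for v
    using fin by auto
  have not_node: "- w \<notin> V" if "w \<in> W" for w
    using ne[of "- w" w] that by auto
  have N_at: "poly N (- w) = (\<Sum>v\<in>V. c v / (v + w)) * (\<Prod>v\<in>V. v + w)" if "w \<in> W" for w
    using poly_partial_fraction_numerator[OF fin(1) not_node[OF that]] by (simp add: N_def)
  have N_node: "poly N v = c v * (\<Prod>u\<in>V - {v}. u - v)" if "v \<in> V" for v
    using poly_partial_fraction_numerator_node[OF fin(1) that] by (simp add: N_def)
  have Q_at: "poly Q (- w) = 0" if "w \<in> W" for w
    unfolding poly_Q using fin that by (intro prod_zero) auto
  show ?thesis
  proof
    assume L: ?L
    obtain v0 where v0: "v0 \<in> V"
      using V_ne by auto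
    \<comment> \<open>The points \<open>- w\<close> number only \<open>card V - 1\<close>, one short
      of determining \<open>N\<close>. The node \<open>v0\<close> is the extra point, and
      \<open>C\<close> is chosen so that the two polynomials agree there.\<close>
    define C where "C = poly N v0 / poly Q v0"
    have "poly Q v0 \<noteq> 0"
      using fin ne[OF v0] by (simp add: poly_Q)
    then have at_v0: "poly N v0 = poly (smult C Q) v0"
      by (simp add: C_def)
    have "N = smult C Q"
    proof (rule poly_eqI_degree[of "insert v0 (uminus ` W)"])
      fix t assume "t \<in> insert v0 (uminus ` W)"
      then show "poly N t = poly (smult C Q) t"
        using at_v0 L N_at Q_at by auto
    next
      have "card (insert v0 (uminus ` W)) = card V"
        using fin card not_node v0 by (subst card_insert_disjoint) (auto simp: card_image)
      then show "degree N < card (insert v0 (uminus ` W))"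
        "degree (smult C Q) < card (insert v0 (uminus ` W))"
        using deg_N deg_Q degree_smult_le[of C Q] by auto
    qed
    then have "c v = C * ((\<Prod>w\<in>W. v + w) / (\<Prod>u\<in>V - {v}. u - v))" if "v \<in> V" for v
      using N_node[OF that] den_ne[of v] by (simp add: poly_Q field_simps)
    then show ?R by blast
  next
    assume ?R
    then obtain C where C: "\<And>v. v \<in> V \<Longrightarrow> c v = C * (poly Q v / (\<Prod>u\<in>V - {v}. u - v))"
      unfolding poly_Q by blast
    have "N = smult C Q"
    \<comment> \<open>Now the nodes are the test points, since the coefficients prescribe the values
      of \<open>N\<close> there.\<close>
    proof (rule poly_eqI_degree[of V])
      show "poly N v = poly (smult C Q) v" if "v \<in> V" for v
        using N_node[OF that] C[OF that] den_ne[of v] by simp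
    qed (use deg_N deg_Q degree_smult_le[of C Q] in auto)
    then have "poly N (- w) = 0" if "w \<in> W" for w
      using Q_at[OF that] by simp
    moreover have "(\<Prod>v\<in>V. v + w) \<noteq> 0" if "w \<in> W" for w
      using fin ne that by auto
    ultimately show ?L
      using N_at by auto
  qed
qed

section \<open>Mellin integrals on (0,1) and linear independence of real powers\<close>

text \<open>Termwise, \<open>x powr (v + w - 1)\<close> integrates to \<open>1 / (v + w)\<close>.
  The exponent \<open>w - 1\<close> turns a moment into the value of the partial fractions at
  \<open>t = - w\<close>.\<close>

lemma has_integral_powr_sum:
  fixes c :: "real \<Rightarrow> real"
  assumes "finite V" "\<And>v. v \<in> V \<Longrightarrow> v + w > 0"
  shows "((\<lambda>x. (\<Sum>v\<in>V. c v * x powr v) * x powr (w - 1)) has_integral (\<Sum>v\<in>V. c v / (v + w)))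
    {0<..<1}"
proof -
  have "((\<lambda>x. \<Sum>v\<in>V. c v * x powr (v + w - 1)) has_integral (\<Sum>v\<in>V. c v * (1 / (v + w)))) {0..1}"
  proof (intro has_integral_sum has_integral_mult_right)
    fix v assume "v \<in> V"
    then show "((\<lambda>x. x powr (v + w - 1)) has_integral 1 / (v + w)) {0..1}"
      using has_integral_powr_from_0[of "v + w - 1" 1] assms(2)[of v] by simp
  qed (use assms in auto)
  then have "((\<lambda>x. \<Sum>v\<in>V. c v * x powr (v + w - 1)) has_integral (\<Sum>v\<in>V. c v / (v + w))) {0<..<1}"
    by (simp add: has_integral_Icc_iff_Ioo)
  then show ?thesis
    by (rule has_integral_eq[rotated])
       (simp add: sum_distrib_right mult.assoc flip: powr_add, simp add: algebra_simps)
qed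

text \<open>Integrating the vanishing sum against \<open>x powr (- t - 1)\<close> gives zeros of the
  partial fractions for all \<open>t\<close> on a half-line. The numerator then has infinitely many
  roots, so it is zero, and its node values give the coefficients.\<close>

lemma powr_sum_eq_zero_imp_coeff_eq_zero:
  fixes c :: "real \<Rightarrow> real"
  assumes fin: "finite V" and zero: "\<And>x. x \<in> {0<..<1} \<Longrightarrow> (\<Sum>v\<in>V. c v * x powr v) = 0"
    and v: "v \<in> V"
  shows "c v = 0"
proof -
  define N where "N = partial_fraction_numerator V c"
  have "bdd_below V"
    using fin by (rule bdd_below_finite)
  \<comment> \<open>For \<open>t\<close> below \<open>B\<close> all exponents satisfy
    \<open>v - t > 0\<close>, so the integrals converge.\<close>
  then obtain B where B: "\<And>v. v \<in> V \<Longrightarrow> B \<le> v"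
    by (auto simp: bdd_below_def)
  have "poly N t = 0" if t: "t < B" for t
  proof -
    have pos: "v + - t > 0" if "v \<in> V" for v
      using B[OF that] t by linarith
    have "((\<lambda>x. (\<Sum>v\<in>V. c v * x powr v) * x powr (- t - 1)) has_integral 0) {0<..<1}"
      by (rule has_integral_is_0) (simp add: zero)
    then have "(\<Sum>v\<in>V. c v / (v + - t)) = 0"
      by (rule has_integral_unique[OF has_integral_powr_sum[OF fin pos], rotated])
    moreover have "t \<notin> V"
      using pos by force
    ultimately show ?thesis
      using poly_partial_fraction_numerator[OF fin] by (simp add: N_def)
  qed
  then have "{..<B} \<subseteq> {t. poly N t = 0}"
    by auto
  then have "infinite {t. poly N t = 0}"
    using infinite_Iio infinite_super by blast
  then have "N = 0"
    using poly_roots_finite by blast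
  moreover have "(\<Prod>u\<in>V - {v}. u - v) \<noteq> 0"
    using fin by auto
  ultimately show ?thesis
    using poly_partial_fraction_numerator_node[OF fin v, of c] by (simp add: N_def)
qed

section \<open>Exponents, poles and zeros as shifted parameters\<close>

text \<open>Serves twice: \<open>a = \<alpha>\<close> gives the exponents, which are also the poles,
  and \<open>a = (\<lambda>j. \<beta> j + 1)\<close> gives the negatives of the zeros of the
  numerator product.\<close>

definition shifted_nodes :: "nat \<Rightarrow> (nat \<Rightarrow> real) \<Rightarrow> (nat \<Rightarrow> nat) \<Rightarrow> real set" where
  "shifted_nodes p a n = (\<lambda>(i, r). a i + real r) ` (SIGMA i:{1..p}. {..<n i})"

lemma finite_shifted_nodes [simp]: "finite (shifted_nodes p a n)"
  by (simp add: shifted_nodes_def)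

lemma pineiro_nodes_eq: "pineiro_nodes p \<alpha> n = complex_of_real ` shifted_nodes p \<alpha> n"
  unfolding pineiro_nodes_def shifted_nodes_def by (auto simp: image_iff; force)

text \<open>A coincidence of two nodes would make a difference of parameters an integer. Injectivity
  makes the poles simple and lets them be counted by the multi-index.\<close>

lemma inj_on_shifted_nodes:
  assumes "\<forall>i\<in>{1..p}. \<forall>h\<in>{1..p}. i \<noteq> h \<longrightarrow> a i - a h \<notin> \<int>"
  shows "inj_on (\<lambda>(i, r). a i + real r) (SIGMA i:{1..p}. {..<n i})"
proof (rule inj_onI, clarify)
  fix i r h s
  assume ih: "i \<in> {1..p}" "h \<in> {1..p}" and eq: "a i + real r = a h + real s"
  have "a i - a h = real_of_int (int s - int r)"
    using eq by simp
  then have "a i - a h \<in> \<int>"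
    using Ints_of_int by metis
  then have "i = h"
    using assms ih by blast
  with eq show "i = h \<and> r = s"
    by simp
qed

lemma card_shifted_nodes:
  assumes "\<forall>i\<in>{1..p}. \<forall>h\<in>{1..p}. i \<noteq> h \<longrightarrow> a i - a h \<notin> \<int>"
  shows "card (shifted_nodes p a n) = (\<Sum>i=1..p. n i)"
  unfolding shifted_nodes_def by (subst card_image[OF inj_on_shifted_nodes[OF assms]]) simp

text \<open>The free \<open>z\<close> covers both products of the integrand: \<open>z = - t\<close>
  for the denominator, \<open>z = t\<close> for the numerator.\<close>

lemma prod_pochhammer_eq_prod_shifted_nodes:
  fixes z :: complex
  assumes "\<forall>i\<in>{1..p}. \<forall>h\<in>{1..p}. i \<noteq> h \<longrightarrow> a i - a h \<notin> \<int>"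
  shows "(\<Prod>i=1..p. pochhammer (of_real (a i) + z) (n i)) = (\<Prod>v\<in>shifted_nodes p a n. of_real v + z)"
  unfolding shifted_nodes_def
  by (subst prod.reindex[OF inj_on_shifted_nodes[OF assms]])
     (simp add: pochhammer_prod prod.Sigma atLeast0LessThan case_prod_unfold algebra_simps)

text \<open>The coefficient of \<open>x ^ r\<close> in \<open>P i\<close> becomes the coefficient of
  the power with exponent \<open>a i + real r\<close>; distinct nodes make this a free choice of
  coefficients.\<close>

lemma poly_powr_sum_iff_shifted_nodes:
  fixes A :: "real \<Rightarrow> real"
  assumes "\<forall>i\<in>{1..p}. \<forall>h\<in>{1..p}. i \<noteq> h \<longrightarrow> a i - a h \<notin> \<int>"
  shows "(\<exists>P :: nat \<Rightarrow> real poly.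
        (\<forall>i\<in>{1..p}. degree (P i) \<le> n i - 1 \<and> (n i = 0 \<longrightarrow> P i = 0)) \<and>
        (\<forall>x\<in>{0<..<1}. A x = (\<Sum>i=1..p. poly (P i) x * x powr a i))) \<longleftrightarrow>
    (\<exists>c. \<forall>x\<in>{0<..<1}. A x = (\<Sum>v\<in>shifted_nodes p a n. c v * x powr v))"
    (is "?L \<longleftrightarrow> ?R")
proof -
  let ?I = "SIGMA i:{1..p}. {..<n i}"
  let ?f = "\<lambda>(i, r). a i + real r"
  note inj = inj_on_shifted_nodes[OF assms, of n]
  have expand: "(\<Sum>i=1..p. (\<Sum>r<n i. c (?f (i, r)) * x ^ r) * x powr a i) =
      (\<Sum>v\<in>shifted_nodes p a n. c v * x powr v)" if "x \<in> {0<..<1}" for c and x :: real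
    using that unfolding shifted_nodes_def
    by (subst sum.reindex[OF inj])
       (simp add: sum.Sigma case_prod_unfold sum_distrib_left powr_add powr_realpow mult_ac)
  show ?thesis
  proof
    assume ?L
    then obtain P where deg: "\<And>i. i \<in> {1..p} \<Longrightarrow> degree (P i) \<le> n i - 1 \<and> (n i = 0 \<longrightarrow> P i = 0)"
      and A: "\<And>x. x \<in> {0<..<1} \<Longrightarrow> A x = (\<Sum>i=1..p. poly (P i) x * x powr a i)"
      by blast
    \<comment> \<open>The inverse of the node map recovers the pair \<open>(i, r)\<close> from the
      exponent.\<close>
    define c where "c v = (case inv_into ?I ?f v of (i, r) \<Rightarrow> coeff (P i) r)" for v
    have c: "c (?f (i, r)) = coeff (P i) r" if "i \<in> {1..p}" "r < n i" for i r
      using inv_into_f_f[OF inj, of "(i, r)"] that by (simp add: c_def)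
    have P: "poly (P i) x = (\<Sum>r<n i. c (?f (i, r)) * x ^ r)" if "i \<in> {1..p}" for i and x :: real
    \<comment> \<open>For \<open>n i = 0\<close> truncated subtraction makes the degree bound 0,
      which still allows constants; the separate clause forces \<open>P i = 0\<close>.\<close>
    proof (cases "n i = 0")
      case True
      then show ?thesis using deg[OF that] by simp
    next
      case False
      then have "{..n i - 1} = {..<n i}" by auto
      then show ?thesis
        using arg_cong[OF poly_as_sum_of_monoms'[of "P i" "n i - 1"], of "\<lambda>P. poly P x"]
          deg[OF that] c[OF that]
        by (simp add: poly_sum poly_monom)
    qed
    have "A x = (\<Sum>v\<in>shifted_nodes p a n. c v * x powr v)" if "x \<in> {0<..<1}" for x
      using A[OF that] P expand[OF that, of c] by simp
    then show ?R by blast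
  next
    assume ?R
    then obtain c where c: "\<And>x. x \<in> {0<..<1} \<Longrightarrow> A x = (\<Sum>v\<in>shifted_nodes p a n. c v * x powr v)"
      by blast
    define P where "P i = (\<Sum>r<n i. monom (c (?f (i, r))) r)" for i
    have "degree (P i) \<le> n i - 1" for i
      unfolding P_def by (intro degree_sum_le) (auto intro: order_trans[OF degree_monom_le])
    moreover have "P i = 0" if "n i = 0" for i
      using that by (simp add: P_def)
    moreover have "A x = (\<Sum>i=1..p. poly (P i) x * x powr a i)" if "x \<in> {0<..<1}" for x
      using c[OF that] expand[OF that, of c] by (simp add: P_def poly_sum poly_monom)
    ultimately show ?L by blast
  qed
qed

section \<open>Evaluation of the contour integral\<close>

text \<open>Partial fractions reduce the integral to Cauchy's formula for the entire function
  \<open>exp (t * s)\<close>, applied at each node separately.\<close>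

lemma contour_integral_exp_partial_fractions:
  fixes V :: "complex set"
  assumes "finite V" "degree P < card V"
    and \<Sigma>: "clockwise_contour_around V \<Sigma>"
  shows "contour_integral \<Sigma>
      (\<lambda>t. exp (t * s) * poly P t / (\<Prod>v\<in>V. v - t) / (2 * complex_of_real pi * \<i>)) =
    (\<Sum>v\<in>V. poly P v / (\<Prod>u\<in>V - {v}. u - v) * exp (v * s))"
proof (rule contour_integral_unique)
  define d where "d v = poly P v / (\<Prod>u\<in>V - {v}. u - v)" for v
  let ?k = "2 * complex_of_real pi * \<i>"
  have "((\<lambda>t. exp (t * s) / (t - v)) has_contour_integral
      ?k * winding_number \<Sigma> v * exp (v * s)) \<Sigma>" if "v \<in> V" for v
  proof -
    have "(\<lambda>t. exp (t * s)) holomorphic_on UNIV"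
      by (intro holomorphic_intros)
    moreover have "path_image \<Sigma> \<subseteq> UNIV - {v}"
      using \<Sigma> that by (auto simp: clockwise_contour_around_def)
    ultimately show ?thesis
      using Cauchy_integral_formula_convex_simple[of UNIV "\<lambda>t. exp (t * s)" v \<Sigma>] \<Sigma>
      by (simp add: clockwise_contour_around_def)
  qed
  \<comment> \<open>The minus sign comes from replacing \<open>v - t\<close> by
    \<open>t - v\<close>; it cancels against the winding number -1 in
    \<open>value_eq\<close>.\<close>
  then have terms: "((\<lambda>t. - d v / ?k * (exp (t * s) / (t - v))) has_contour_integral
      - d v / ?k * (?k * winding_number \<Sigma> v * exp (v * s))) \<Sigma>" if "v \<in> V" for v
    using that by (intro has_contour_integral_lmul)
  have value_eq: "- d v / ?k * (?k * winding_number \<Sigma> v * exp (v * s)) = d v * exp (v * s)"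
    if "v \<in> V" for v
  proof -
    have "?k \<noteq> 0" "winding_number \<Sigma> v = -1"
      using \<Sigma> that by (auto simp: clockwise_contour_around_def)
    then show ?thesis
      by (simp only: divide_inverse) (simp add: field_simps)
  qed
  have "((\<lambda>t. - d v / ?k * (exp (t * s) / (t - v))) has_contour_integral
      d v * exp (v * s)) \<Sigma>" if "v \<in> V" for v
    using terms[OF that] unfolding value_eq[OF that] .
  then have "((\<lambda>t. \<Sum>v\<in>V. - d v / ?k * (exp (t * s) / (t - v))) has_contour_integral
      (\<Sum>v\<in>V. d v * exp (v * s))) \<Sigma>"
    using assms(1) by (intro has_contour_integral_sum) auto
  then show "((\<lambda>t. exp (t * s) * poly P t / (\<Prod>v\<in>V. v - t) / ?k) has_contour_integral
      (\<Sum>v\<in>V. poly P v / (\<Prod>u\<in>V - {v}. u - v) * exp (v * s))) \<Sigma>"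
    unfolding d_def[symmetric]
  \<comment> \<open>The integrands need to agree only on the path, which avoids the nodes.\<close>
  proof (rule has_contour_integral_eq)
    fix t assume t: "t \<in> path_image \<Sigma>"
    then have "t \<notin> V"
      using \<Sigma> by (auto simp: clockwise_contour_around_def)
    have "exp (t * s) * poly P t / (\<Prod>v\<in>V. v - t) / ?k =
        (\<Sum>v\<in>V. d v / (v - t)) * (exp (t * s) / ?k)"
      unfolding d_def partial_fraction_decomposition[OF assms(1,2) \<open>t \<notin> V\<close>, symmetric]
      by (simp add: mult_ac)
    also have "\<dots> = (\<Sum>v\<in>V. - d v / ?k * (exp (t * s) / (t - v)))"
      unfolding sum_distrib_right
    proof (rule sum.cong[OF refl])
      fix v assume "v \<in> V"
      then have "v - t \<noteq> 0" "t - v \<noteq> 0"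
        using \<open>t \<notin> V\<close> by auto
      then show "d v / (v - t) * (exp (t * s) / ?k) = - d v / ?k * (exp (t * s) / (t - v))"
        by (simp add: divide_simps) (simp add: algebra_simps)
    qed
    finally show "(\<Sum>v\<in>V. - d v / ?k * (exp (t * s) / (t - v))) =
        exp (t * s) * poly P t / (\<Prod>v\<in>V. v - t) / ?k"
      by simp
  qed
qed

text \<open>Take \<open>s = ln x\<close>: at a real node the exponential is \<open>x powr v\<close>,
  so the value is real. The relation between the multi-indices makes the degree of the numerator
  product smaller than the number of poles.\<close>

lemma contour_integral_pineiro_integrand:
  assumes \<alpha>: "\<forall>i\<in>{1..p}. \<forall>h\<in>{1..p}. i \<noteq> h \<longrightarrow> \<alpha> i - \<alpha> h \<notin> \<int>"
    and \<beta>: "\<forall>j\<in>{1..q}. \<forall>s\<in>{1..q}. j \<noteq> s \<longrightarrow> \<beta> j - \<beta> s \<notin> \<int>"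
    and nm: "(\<Sum>i=1..p. n i) = (\<Sum>j=1..q. m j) + 1"
    and \<Sigma>: "clockwise_contour_around (pineiro_nodes p \<alpha> n) \<Sigma>"
    and x: "x > 0"
  defines "V \<equiv> shifted_nodes p \<alpha> n" and "W \<equiv> shifted_nodes q (\<lambda>j. \<beta> j + 1) m"
  shows "contour_integral \<Sigma>
      (\<lambda>t. pineiro_integrand p q \<alpha> \<beta> n m x t / (2 * complex_of_real pi * \<i>)) =
    complex_of_real (\<Sum>v\<in>V. (\<Prod>w\<in>W. v + w) / (\<Prod>u\<in>V - {v}. u - v) * x powr v)"
proof -
  define VC where "VC = complex_of_real ` V"
  define Q where "Q = (\<Prod>w\<in>W. [:complex_of_real w, 1:])"
  have \<beta>': "\<forall>j\<in>{1..q}. \<forall>s\<in>{1..q}. j \<noteq> s \<longrightarrow> (\<beta> j + 1) - (\<beta> s + 1) \<notin> \<int>"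
    using \<beta> by simp
  have fin: "finite VC" "finite V" "finite W"
    by (auto simp: VC_def V_def W_def)
  have inj: "inj_on complex_of_real X" for X
    by (simp add: inj_on_def)
  have poly_Q: "poly Q t = (\<Prod>w\<in>W. t + of_real w)" for t
    by (simp add: Q_def poly_prod add.commute)
  have "degree Q \<le> card W"
    using degree_prod_sum_le[of W "\<lambda>w. [:complex_of_real w, 1:]"] fin by (simp add: Q_def o_def)
  moreover have "card VC = card W + 1"
    using nm card_shifted_nodes[OF \<alpha>, of n] card_shifted_nodes[OF \<beta>', of m]
    by (simp add: VC_def V_def W_def card_image[OF inj])
  ultimately have deg: "degree Q < card VC"
    by simp
  have "pineiro_integrand p q \<alpha> \<beta> n m x t =
      exp (t * of_real (ln x)) * poly Q t / (\<Prod>v\<in>VC. v - t)" for t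
    using prod_pochhammer_eq_prod_shifted_nodes[OF \<alpha>, of "- t" n]
      prod_pochhammer_eq_prod_shifted_nodes[OF \<beta>', of t m]
    by (simp add: pineiro_integrand_def poly_Q VC_def V_def W_def prod.reindex[OF inj] add_ac)
  then have "contour_integral \<Sigma>
      (\<lambda>t. pineiro_integrand p q \<alpha> \<beta> n m x t / (2 * complex_of_real pi * \<i>)) =
    (\<Sum>v\<in>VC. poly Q v / (\<Prod>u\<in>VC - {v}. u - v) * exp (v * of_real (ln x)))"
    using contour_integral_exp_partial_fractions[OF fin(1) deg, of \<Sigma>] \<Sigma>
    by (simp add: pineiro_nodes_eq VC_def V_def)
  also have "\<dots> = (\<Sum>v\<in>V. of_real ((\<Prod>w\<in>W. v + w) / (\<Prod>u\<in>V - {v}. u - v) * x powr v))"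
    unfolding VC_def sum.reindex[OF inj] o_def
  proof (rule sum.cong[OF refl])
    fix v
    have "complex_of_real ` V - {of_real v} = complex_of_real ` (V - {v})"
      by auto
    moreover have "exp (complex_of_real v * of_real (ln x)) = of_real (x powr v)"
      using x by (simp add: powr_def exp_of_real flip: of_real_mult)
    ultimately show "poly Q (of_real v) / (\<Prod>u\<in>complex_of_real ` V - {of_real v}. u - of_real v) *
        exp (of_real v * of_real (ln x)) =
        of_real ((\<Prod>w\<in>W. v + w) / (\<Prod>u\<in>V - {v}. u - v) * x powr v)"
      by (simp add: poly_Q prod.reindex[OF inj])
  qed
  finally show ?thesis by simp
qed

section \<open>Type-I forms as the nonzero multiples of the contour integral\<close>

theorem proposition5p1:
  fixes p q :: nat and \<alpha> \<beta> :: "nat \<Rightarrow> real" and n m :: "nat \<Rightarrow> nat"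
    and \<Sigma> :: "real \<Rightarrow> complex" and A :: "real \<Rightarrow> real"
  assumes "p \<ge> 1" and "q \<ge> 1"
    and "pineiro_parameters p q \<alpha> \<beta>"
    and "(\<Sum>i=1..p. n i) = (\<Sum>j=1..q. m j) + 1"
    and "clockwise_contour_around (pineiro_nodes p \<alpha> n) \<Sigma>"
    and "\<forall>x\<in>{0<..<1}. encloses_no_other_pole (pineiro_nodes p \<alpha> n)
           (pineiro_integrand p q \<alpha> \<beta> n m x) \<Sigma>"
  shows "type_I_mixed_pineiro_form p q \<alpha> \<beta> n m A \<longleftrightarrow>
         (\<exists>c::real. c \<noteq> 0 \<and>
            (\<forall>x\<in>{0<..<1}. complex_of_real (A x) =
               complex_of_real c *
               contour_integral \<Sigma>
                 (\<lambda>t. pineiro_integrand p q \<alpha> \<beta> n m x t / (2 * complex_of_real pi * \<i>))))"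
proof -
  define V where "V = shifted_nodes p \<alpha> n"
  define W where "W = shifted_nodes q (\<lambda>j. \<beta> j + 1) m"
  define d where "d v = (\<Prod>w\<in>W. v + w) / (\<Prod>u\<in>V - {v}. u - v)" for v
  define F where "F x = (\<Sum>v\<in>V. d v * x powr v)" for x
  have \<alpha>: "\<forall>i\<in>{1..p}. \<forall>h\<in>{1..p}. i \<noteq> h \<longrightarrow> \<alpha> i - \<alpha> h \<notin> \<int>"
    and \<beta>: "\<forall>j\<in>{1..q}. \<forall>s\<in>{1..q}. j \<noteq> s \<longrightarrow> \<beta> j - \<beta> s \<notin> \<int>"
    and sum_gt: "\<forall>i\<in>{1..p}. \<forall>j\<in>{1..q}. \<alpha> i + \<beta> j > -1"
    using assms(3) by (auto simp: pineiro_parameters_def)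
  have \<beta>': "\<forall>j\<in>{1..q}. \<forall>s\<in>{1..q}. j \<noteq> s \<longrightarrow> (\<beta> j + 1) - (\<beta> s + 1) \<notin> \<int>"
    using \<beta> by simp
  have fin: "finite V" "finite W"
    by (auto simp: V_def W_def)
  have card: "card V = card W + 1"
    using assms(4) card_shifted_nodes[OF \<alpha>, of n] card_shifted_nodes[OF \<beta>', of m]
    by (simp add: V_def W_def)
  \<comment> \<open>Here \<open>v + w\<close> is \<open>\<alpha> i + \<beta> j + 1\<close> plus a
    natural number. Positivity gives both convergence of the moments and
    \<open>v \<noteq> - w\<close>.\<close>
  have pos: "v + w > 0" if "v \<in> V" "w \<in> W" for v w
    using that sum_gt by (force simp: V_def W_def shifted_nodes_def)
  have integral: "contour_integral \<Sigma>
      (\<lambda>t. pineiro_integrand p q \<alpha> \<beta> n m x t / (2 * complex_of_real pi * \<i>)) = of_real (F x)"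
    if "x \<in> {0<..<1}" for x
    using contour_integral_pineiro_integrand[OF \<alpha> \<beta> assms(4,5), of x] that
    by (simp add: F_def d_def V_def W_def)
  \<comment> \<open>With \<open>w = \<beta> j + 1 + k\<close> the weight is
    \<open>x powr (w - 1)\<close>, so orthogonality says that the partial fractions with
    coefficients \<open>c\<close> vanish at every \<open>- w\<close>.\<close>
  have orth: "(\<forall>j\<in>{1..q}. \<forall>k<m j. ((\<lambda>x. A x * x powr (real k + \<beta> j)) has_integral 0) {0<..<1}) \<longleftrightarrow>
      (\<exists>C. \<forall>v\<in>V. c v = C * d v)"
    if A: "\<And>x. x \<in> {0<..<1} \<Longrightarrow> A x = (\<Sum>v\<in>V. c v * x powr v)" for c
  proof -
    have "((\<lambda>x. A x * x powr (w - 1)) has_integral 0) {0<..<1} \<longleftrightarrow> (\<Sum>v\<in>V. c v / (v + w)) = 0"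
      if "w \<in> W" for w
    proof -
      have "((\<lambda>x. A x * x powr (w - 1)) has_integral (\<Sum>v\<in>V. c v / (v + w))) {0<..<1}"
        by (rule has_integral_eq[OF _ has_integral_powr_sum[OF fin(1)]])
           (use pos that A in auto)
      then show ?thesis
        using has_integral_unique by metis
    qed
    moreover have "(\<forall>j\<in>{1..q}. \<forall>k<m j.
        ((\<lambda>x. A x * x powr (real k + \<beta> j)) has_integral 0) {0<..<1}) \<longleftrightarrow>
        (\<forall>w\<in>W. ((\<lambda>x. A x * x powr (w - 1)) has_integral 0) {0<..<1})"
      by (fastforce simp: W_def shifted_nodes_def add_ac)
    ultimately have "(\<forall>j\<in>{1..q}. \<forall>k<m j.
        ((\<lambda>x. A x * x powr (real k + \<beta> j)) has_integral 0) {0<..<1}) \<longleftrightarrow>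
        (\<forall>w\<in>W. (\<Sum>v\<in>V. c v / (v + w)) = 0)"
      by simp
    also have "\<dots> \<longleftrightarrow> (\<exists>C. \<forall>v\<in>V. c v = C * d v)"
      unfolding d_def using pos by (intro partial_fractions_vanish_iff fin card) force
    finally show ?thesis .
  qed
  \<comment> \<open>Each \<open>d v\<close> is nonzero because no node is a zero \<open>- w\<close>
    of the numerator; independence of the powers then excludes \<open>F = 0\<close>.\<close>
  have F_ne: "\<exists>x\<in>{0<..<1}. F x \<noteq> 0"
  proof (rule ccontr)
    assume "\<not> ?thesis"
    then have F0: "(\<Sum>v\<in>V. d v * x powr v) = 0" if "x \<in> {0<..<1}" for x
      using that by (auto simp: F_def)
    obtain v where v: "v \<in> V"
      using card by fastforce
    have "(\<Prod>w\<in>W. v + w) \<noteq> 0" "(\<Prod>u\<in>V - {v}. u - v) \<noteq> 0"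
      using fin pos[OF v] by force+
    then have "d v \<noteq> 0"
      by (simp add: d_def)
    then show False
      using powr_sum_eq_zero_imp_coeff_eq_zero[OF fin(1) F0 v] by simp
  qed
  have "type_I_mixed_pineiro_form p q \<alpha> \<beta> n m A \<longleftrightarrow>
      (\<exists>C. C \<noteq> 0 \<and> (\<forall>x\<in>{0<..<1}. A x = C * F x))" (is "_ \<longleftrightarrow> ?R")
    unfolding type_I_mixed_pineiro_form_def poly_powr_sum_iff_shifted_nodes[OF \<alpha>, of n A] V_def[symmetric]
  proof (intro iffI; (elim conjE exE)?)
    fix c assume c: "\<forall>x\<in>{0<..<1}. A x = (\<Sum>v\<in>V. c v * x powr v)"
      and ne: "\<exists>x\<in>{0<..<1}. A x \<noteq> 0"
      and "\<forall>j\<in>{1..q}. \<forall>k<m j. ((\<lambda>x. A x * x powr (real k + \<beta> j)) has_integral 0) {0<..<1}"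
    then have "\<exists>C. \<forall>v\<in>V. c v = C * d v"
      using orth[of c] by blast
    then obtain C where C: "\<And>v. v \<in> V \<Longrightarrow> c v = C * d v"
      by blast
    have AF: "\<forall>x\<in>{0<..<1}. A x = C * F x"
      using c C by (simp add: F_def sum_distrib_left mult.assoc)
    then have "C \<noteq> 0"
      using ne by auto
    with AF show ?R by blast
  next
    fix C :: real assume C: "C \<noteq> 0" and AF: "\<forall>x\<in>{0<..<1}. A x = C * F x"
    then have A: "\<forall>x\<in>{0<..<1}. A x = (\<Sum>v\<in>V. C * d v * x powr v)"
      by (simp add: F_def sum_distrib_left mult.assoc)
    moreover have "\<exists>x\<in>{0<..<1}. A x \<noteq> 0"
      using F_ne C AF by auto
    moreover have "\<forall>j\<in>{1..q}. \<forall>k<m j. ((\<lambda>x. A x * x powr (real k + \<beta> j)) has_integral 0) {0<..<1}"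
      using orth[of "\<lambda>v. C * d v"] A by auto
    ultimately show "(\<exists>c. \<forall>x\<in>{0<..<1}. A x = (\<Sum>v\<in>V. c v * x powr v)) \<and>
        (\<exists>x\<in>{0<..<1}. A x \<noteq> 0) \<and>
        (\<forall>j\<in>{1..q}. \<forall>k<m j. ((\<lambda>x. A x * x powr (real k + \<beta> j)) has_integral 0) {0<..<1})"
      by (intro conjI exI[of _ "\<lambda>v. C * d v"])
  qed
  also have "\<dots> \<longleftrightarrow> (\<exists>c::real. c \<noteq> 0 \<and>
            (\<forall>x\<in>{0<..<1}. complex_of_real (A x) =
               complex_of_real c *
               contour_integral \<Sigma>
                 (\<lambda>t. pineiro_integrand p q \<alpha> \<beta> n m x t / (2 * complex_of_real pi * \<i>))))"
    \<comment> \<open>On (0,1) the integral is the real number \<open>F x\<close>, so the complex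
      equation is the embedded real one.\<close>
    by (simp add: integral flip: of_real_mult)
  finally show ?thesis .
qed

end
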